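(* (Failure probability bound, uniformly distributed affine diffusion.) Let $D$, $a$, $b$, $\mathcal N(a,b)$, $c$, $\beta_N$, $c_\beta$, and the random field $\nu$ with $\nu_{\min}$, $\nu^*$ be as in the context, and put $\Gamma(\omega)=\sum_{j=1}^\infty|z_j(\omega)|\,\|\psi_j\|_{L^\infty(D)}$. Let $\bar N\ge1$ be an integer with $\nu^*-\sqrt3\,c\,\mathcal N(a,b)\,\beta_{\bar N}^{-1/2}>0$ (recall that $\beta_N\to\infty$ as $N\to\infty$). Then the failure probability satisfies $$\mathbb P\left[\nu_{\min}^2(\omega)\,\beta_{\bar N}\le3c^2\mathcal N^2(a,b)\right]\le\frac{\mathbb E[\Gamma]}{\nu^*-\sqrt3\,c\,\mathcal N(a,b)\,\beta_{\bar N}^{-1/2}}\le\frac{\sum_{j\ge1}\mathbb E[|z_j|]\,\|\psi_j\|_{L^\infty(D)}}{\nu^*-\left(\frac3{c_\beta}\right)^{1/2}c\,\mathcal N(a,b)\,\bar N^{-1}}.$$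
   Context: $D=\prod_{n=1}^d(0,L_n)\subset\mathbb R^d$, $L_n>0$; $H=L^2(D;\mathbb R)$, $V=H_0^1(D;\mathbb R)$ with $\|v\|_V=\|\nabla v\|_{L^2(D)}$. $(\Omega,\mathcal F,\mathbb P)$ is a complete probability space. $a\in L^\infty((0,\infty);L^r(D;\mathbb R))$ with $r\ge d$, $b\in L^\infty((0,\infty)\times D;\mathbb R^d)$, $\mathcal N(a,b)=\|a\|_{L^\infty((0,\infty);L^r(D))}+\|b\|_{L^\infty((0,\infty)\times D;\mathbb R^d)}$. The constant $c>0$ depends only on $D$ and is such that $|\langle a(t)y,y\rangle_{V',V}|+|(b(t)y,\nabla y)_{H}|\le c\,\mathcal N(a,b)\|y\|_H\|y\|_V$ for all $y\in V$ and a.e. $t>0$. Fix $\varrho\in(0,1)$. For $N\ge1$ and $\mathbf i\in\{1,\dots,N\}^d$ let $O_{\mathbf i,N}=\prod_{n=1}^d\big(\frac{(2i_n-1)L_n}{2N}-\frac{\varrho L_n}{2N},\frac{(2i_n-1)L_n}{2N}+\frac{\varrho L_n}{2N}\big)$, let $\mathcal O_N$ be the span of the indicator functions $\mathbf 1_{O_{\mathbf i,N}}$, and $\beta_N=\inf\{\|Q\|_V^2/\|Q\|_H^2:Q\in V\cap\mathcal O_N^\perp,\ Q\ne0\}$, where $\perp$ is the orthogonal complement in $H$. The constant $c_\beta>0$ is independent of $N$ and satisfies $\beta_N\ge c_\beta N^2$ for all $N\ge 1$ (such a constant exists). Diffusion: $\nu(\omega,x)=\nu_0(x)+\sum_{j=1}^\infty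 z_j(\omega)\psi_j(x)$ with $\nu_0,\psi_j\in L^\infty(D;\mathbb R)$, $\nu^*:=\operatorname{ess\,inf}_D\nu_0>0$, $z_j$ independent, identically uniformly distributed in $[-1,1]$, and $\sum_{j\ge1}\|\psi_j\|_{L^\infty(D)}\le\frac{\kappa}{1+\kappa}\nu^*$ for some $\kappa>0$. Set $\nu_{\min}(\omega)=\nu^*-\sum_{j\ge1}|z_j(\omega)|\|\psi_j\|_{L^\infty(D)}$. "Failure" with $\bar N$ as actuator parameter means the event $\nu_{\min}^2(\omega)\beta_{\bar N}\le3c^2\mathcal N^2(a,b)$, i.e. the condition $\beta_{\bar N}>3c^2\mathcal N^2(a,b)/\nu_{\min}^2(\omega)$ guaranteeing stabilizability of the controlled parabolic equation $\partial_ty-\nabla\cdot(\nu\nabla y)+ay+\nabla\cdot(by)=\sum_{\mathbf i}u_{\mathbf i}\mathbf 1_{O_{\mathbf i,\bar N}}$ by the receding horizon control does not hold.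
   Formalization: The second inequality is stated only when its denominator ν* − (3/c_β)^{1/2} c N(a,b)/N̄ is positive; otherwise (e.g. for a very small admissible c_β) the right side is negative or undefined while the middle term is positive, so the printed inequality fails. *)

theory Defs
  imports "HOL-Probability.Probability"
begin

section \<open>Lebesgue spaces\<close>

text \<open>
  Elements of Lebesgue and Sobolev spaces are represented by functions, without passing to
  classes modulo null sets; accordingly nonzero elements are those that are not almost everywhere zero.
\<close>

definition Lp :: "real \<Rightarrow> 'a measure \<Rightarrow> ('a \<Rightarrow> 'b :: euclidean_space) set" where
  "Lp p M = {f \<in> borel_measurable M. integrable M (\<lambda>x. norm (f x) powr p)}"

definition Lp_norm :: "real \<Rightarrow> 'a measure \<Rightarrow> ('a \<Rightarrow> 'b :: euclidean_space) \<Rightarrow> real" where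
  "Lp_norm p M f = (LINT x|M. norm (f x) powr p) powr (1 / p)"

definition Linf :: "'a measure \<Rightarrow> ('a \<Rightarrow> 'b :: euclidean_space) set" where
  "Linf M = {f \<in> borel_measurable M. esssup M (\<lambda>x. ennreal (norm (f x))) < \<infinity>}"

definition Linf_norm :: "'a measure \<Rightarrow> ('a \<Rightarrow> 'b :: euclidean_space) \<Rightarrow> real" where
  "Linf_norm M f = enn2real (esssup M (\<lambda>x. ennreal (norm (f x))))"

definition essinf :: "'a measure \<Rightarrow> ('a \<Rightarrow> real) \<Rightarrow> ereal" where
  "essinf M f = - esssup M (\<lambda>x. - ereal (f x))"

abbreviation time_axis :: "real measure" where
  "time_axis \<equiv> lebesgue_on {0<..}"

abbreviation space_time :: "'a :: euclidean_space set \<Rightarrow> (real \<times> 'a) measure" where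
  "space_time D \<equiv> lebesgue_on ({0<..} \<times> D)"

text \<open>
  The Bochner space \<open>L\<^sup>\<infinity>((0,\<infinity>); L\<^sup>r(D))\<close>, for finite \<open>r\<close>. As \<open>L\<^sup>r(D)\<close> is then separable, a strongly
  measurable function of time with values in it is the same as a jointly measurable function of
  time and space almost all of whose time slices are in \<open>L\<^sup>r(D)\<close>.
\<close>

definition Linf_Lp :: "real \<Rightarrow> 'a :: euclidean_space set \<Rightarrow> (real \<Rightarrow> 'a \<Rightarrow> real) set" where
  "Linf_Lp r D = {a. (\<lambda>(t, x). a t x) \<in> borel_measurable (space_time D)
     \<and> (AE t in time_axis. a t \<in> Lp r (lebesgue_on D))
     \<and> (\<lambda>t. Lp_norm r (lebesgue_on D) (a t)) \<in> Linf time_axis}"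

text \<open>The quantity \<open>\<N>(a,b)\<close>, where \<open>a \<in> L\<^sup>\<infinity>((0,\<infinity>); L\<^sup>r(D))\<close>.\<close>

definition coeff_norm ::
  "real \<Rightarrow> (real^'d) set \<Rightarrow> (real \<Rightarrow> real^'d \<Rightarrow> real) \<Rightarrow> (real \<Rightarrow> real^'d \<Rightarrow> real^'d) \<Rightarrow> real" where
  "coeff_norm r D a b = Linf_norm time_axis (\<lambda>t. Lp_norm r (lebesgue_on D) (a t))
     + Linf_norm (space_time D) (\<lambda>(t, x). b t x)"


section \<open>The Sobolev space of functions vanishing on the boundary\<close>

definition partial_deriv :: "'d \<Rightarrow> (real^'d \<Rightarrow> real) \<Rightarrow> real^'d \<Rightarrow> real" where
  "partial_deriv i f x = frechet_derivative f (at x) (axis i 1)"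

definition grad :: "(real^'d \<Rightarrow> real) \<Rightarrow> real^'d \<Rightarrow> real^'d" where
  "grad f x = (\<chi> i. partial_deriv i f x)"

primrec Ck :: "nat \<Rightarrow> (real^'d \<Rightarrow> real) \<Rightarrow> bool" where
  "Ck 0 f \<longleftrightarrow> continuous_on UNIV f"
| "Ck (Suc k) f \<longleftrightarrow> (\<forall>x. f differentiable (at x)) \<and> (\<forall>i. Ck k (partial_deriv i f))"

definition test_functions :: "(real^'d) set \<Rightarrow> (real^'d \<Rightarrow> real) set" where
  "test_functions D = {\<phi>. (\<forall>k. Ck k \<phi>)
     \<and> compact (closure {x. \<phi> x \<noteq> 0}) \<and> closure {x. \<phi> x \<noteq> 0} \<subseteq> D}"

abbreviation H_space :: "(real^'d) set \<Rightarrow> (real^'d \<Rightarrow> real) set" where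
  "H_space D \<equiv> Lp 2 (lebesgue_on D)"

abbreviation H_norm :: "(real^'d) set \<Rightarrow> (real^'d \<Rightarrow> real) \<Rightarrow> real" where
  "H_norm D \<equiv> Lp_norm 2 (lebesgue_on D)"

definition H_inner :: "(real^'d) set \<Rightarrow> (real^'d \<Rightarrow> real) \<Rightarrow> (real^'d \<Rightarrow> real) \<Rightarrow> real" where
  "H_inner D f g = (LINT x|lebesgue_on D. f x * g x)"

definition has_weak_grad ::
  "(real^'d) set \<Rightarrow> (real^'d \<Rightarrow> real) \<Rightarrow> (real^'d \<Rightarrow> real^'d) \<Rightarrow> bool" where
  "has_weak_grad D v g \<longleftrightarrow> g \<in> Lp 2 (lebesgue_on D)
     \<and> (\<forall>\<phi>\<in>test_functions D. \<forall>i. H_inner D v (partial_deriv i \<phi>) = - H_inner D (\<lambda>x. g x $ i) \<phi>)"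

text \<open>The weak gradient is determined only up to null sets, so a representative is chosen.\<close>

definition weak_grad :: "(real^'d) set \<Rightarrow> (real^'d \<Rightarrow> real) \<Rightarrow> real^'d \<Rightarrow> real^'d" where
  "weak_grad D v = (SOME g. has_weak_grad D v g)"

text \<open>The closure of the test functions in \<open>H\<^sup>1(D)\<close>.\<close>

definition V_space :: "(real^'d) set \<Rightarrow> (real^'d \<Rightarrow> real) set" where
  "V_space D = {v \<in> H_space D. \<exists>g. has_weak_grad D v g
     \<and> (\<exists>\<phi>. (\<forall>k. \<phi> k \<in> test_functions D)
          \<and> (\<lambda>k::nat. H_norm D (\<lambda>x. \<phi> k x - v x)) \<longlonglongrightarrow> 0
          \<and> (\<lambda>k. Lp_norm 2 (lebesgue_on D) (\<lambda>x. grad (\<phi> k) x - g x)) \<longlonglongrightarrow> 0)}"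

definition V_norm :: "(real^'d) set \<Rightarrow> (real^'d \<Rightarrow> real) \<Rightarrow> real" where
  "V_norm D v = Lp_norm 2 (lebesgue_on D) (weak_grad D v)"

text \<open>
  The bound on the lower-order terms. That \<open>c\<close> depends only on \<open>D\<close> means that one \<open>c\<close> serves all
  coefficients \<open>a\<close>, \<open>b\<close> and all exponents \<open>r \<ge> d\<close>. The first integral is the duality product
  \<open>\<langle>a(t)y, y\<rangle>\<close> of \<open>V'\<close> and \<open>V\<close>, the second one is \<open>(b(t)y, \<nabla>y)\<close>.
\<close>

definition lower_order_const :: "(real^'d) set \<Rightarrow> real \<Rightarrow> bool" where
  "lower_order_const D c \<longleftrightarrow> c > 0
     \<and> (\<forall>r a b. r \<ge> real CARD('d) \<longrightarrow> a \<in> Linf_Lp r D \<longrightarrow> (\<lambda>(t, x). b t x) \<in> Linf (space_time D) \<longrightarrow>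
          (AE t in time_axis. \<forall>y\<in>V_space D.
             \<bar>LINT x|lebesgue_on D. (a t x * y x) * y x\<bar>
             + \<bar>LINT x|lebesgue_on D. (y x *\<^sub>R b t x) \<bullet> weak_grad D y x\<bar>
             \<le> c * coeff_norm r D a b * H_norm D y * V_norm D y))"


section \<open>Actuators\<close>

definition actuator_dom :: "real^'d \<Rightarrow> real \<Rightarrow> nat \<Rightarrow> nat^'d \<Rightarrow> (real^'d) set" where
  "actuator_dom L \<rho> N i =
     box (\<chi> n. (2 * real (i $ n) - 1) * L $ n / (2 * real N) - \<rho> * L $ n / (2 * real N))
         (\<chi> n. (2 * real (i $ n) - 1) * L $ n / (2 * real N) + \<rho> * L $ n / (2 * real N))"

definition actuator_span :: "real^'d \<Rightarrow> real \<Rightarrow> nat \<Rightarrow> (real^'d \<Rightarrow> real) set" where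
  "actuator_span L \<rho> N =
     {\<lambda>x. \<Sum>i | \<forall>n. i $ n \<in> {1..N}. u i * indicator (actuator_dom L \<rho> N i) x | u. True}"

definition orth_compl :: "(real^'d) set \<Rightarrow> (real^'d \<Rightarrow> real) set \<Rightarrow> (real^'d \<Rightarrow> real) set" where
  "orth_compl D W = {Q \<in> H_space D. \<forall>g\<in>W. H_inner D Q g = 0}"

definition beta :: "real^'d \<Rightarrow> real \<Rightarrow> nat \<Rightarrow> real" where
  "beta L \<rho> N = (let D = box 0 L in
     Inf {(V_norm D Q)\<^sup>2 / (H_norm D Q)\<^sup>2 | Q.
       Q \<in> V_space D \<inter> orth_compl D (actuator_span L \<rho> N)
       \<and> \<not> (AE x in lebesgue_on D. Q x = 0)})"


section \<open>The random diffusion coefficient\<close>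

text \<open>The sequences \<open>(\<psi>\<^sub>j)\<close> and \<open>(z\<^sub>j)\<close> are indexed from \<open>0\<close> instead of \<open>1\<close>.\<close>

definition affine_field ::
  "('a \<Rightarrow> real) \<Rightarrow> (nat \<Rightarrow> 'a \<Rightarrow> real) \<Rightarrow> (nat \<Rightarrow> 'w \<Rightarrow> real) \<Rightarrow> 'w \<Rightarrow> 'a \<Rightarrow> real" where
  "affine_field \<nu>0 \<psi> z \<omega> x = \<nu>0 x + (\<Sum>j. z j \<omega> * \<psi> j x)"

definition Gamma_sum ::
  "'a measure \<Rightarrow> (nat \<Rightarrow> 'a \<Rightarrow> real) \<Rightarrow> (nat \<Rightarrow> 'w \<Rightarrow> real) \<Rightarrow> 'w \<Rightarrow> real" where
  "Gamma_sum M \<psi> z \<omega> = (\<Sum>j. \<bar>z j \<omega>\<bar> * Linf_norm M (\<psi> j))"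

definition nu_star :: "'a measure \<Rightarrow> ('a \<Rightarrow> real) \<Rightarrow> real" where
  "nu_star M \<nu>0 = real_of_ereal (essinf M \<nu>0)"

definition nu_min ::
  "'a measure \<Rightarrow> ('a \<Rightarrow> real) \<Rightarrow> (nat \<Rightarrow> 'a \<Rightarrow> real) \<Rightarrow> (nat \<Rightarrow> 'w \<Rightarrow> real) \<Rightarrow> 'w \<Rightarrow> real" where
  "nu_min M \<nu>0 \<psi> z \<omega> = nu_star M \<nu>0 - (\<Sum>j. \<bar>z j \<omega>\<bar> * Linf_norm M (\<psi> j))"

end

theory Submission
  imports Defs
begin

text \<open>
  The failure event is a tail event of the random variable
  \<open>\<Gamma> = (\<Sum>j. \<bar>z j\<bar> * \<parallel>\<psi> j\<parallel>)\<close>, and the theorem is Markov's inequality for it. Write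
  \<open>K = c * \<N>(a,b)\<close> and \<open>\<beta>\<close> for the spectral quantity of the actuators, which is positive by its
  quadratic lower bound. If \<open>\<nu>\<^sub>m\<^sub>i\<^sub>n\<^sup>2 * \<beta> \<le> 3 * K\<^sup>2\<close>, then \<open>\<nu>\<^sub>m\<^sub>i\<^sub>n \<le> sqrt 3 * K * \<beta> powr (-1/2)\<close>; as
  \<open>\<nu>\<^sub>m\<^sub>i\<^sub>n = \<nu>\<^sup>* - \<Gamma>\<close>, this says that \<open>\<Gamma>\<close> is at least the (positive) threshold
  \<open>\<nu>\<^sup>* - sqrt 3 * K * \<beta> powr (-1/2)\<close>.

  Markov's inequality needs \<open>\<Gamma>\<close> to be integrable. This, and the interchange of expectation and
  series that turns \<open>E \<Gamma>\<close> into the last numerator, holds because the \<open>z j\<close> are almost surely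
  bounded by 1 and the weights are summable (lemma \<open>weighted_abs_series\<close>). The last
  denominator comes from replacing \<open>\<beta>\<close> by its lower bound, which only decreases the threshold.
\<close>

text \<open>
  The weights dominate the terms almost surely and in mean, which is what dominated convergence
  for series of integrable functions requires. The nonnegativity is only almost sure, because the
  series may diverge, with unspecified value, on the null set where some \<open>\<bar>z j\<bar>\<close> exceeds 1.
\<close>

lemma weighted_abs_series:
  fixes z :: "nat \<Rightarrow> 'w \<Rightarrow> real" and w :: "nat \<Rightarrow> real"
  assumes "prob_space P"
    and meas: "\<And>j. z j \<in> borel_measurable P"
    and bound: "\<And>j. AE \<omega> in P. \<bar>z j \<omega>\<bar> \<le> 1"
    and w: "\<And>j. w j \<ge> 0" "summable w"
  shows "integrable P (\<lambda>\<omega>. \<Sum>j. \<bar>z j \<omega>\<bar> * w j)"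
    and "AE \<omega> in P. (\<Sum>j. \<bar>z j \<omega>\<bar> * w j) \<ge> 0"
    and "(LINT \<omega>|P. (\<Sum>j. \<bar>z j \<omega>\<bar> * w j)) = (\<Sum>j. (LINT \<omega>|P. \<bar>z j \<omega>\<bar>) * w j)"
proof -
  interpret prob_space P by fact
  have int_z: "integrable P (\<lambda>\<omega>. \<bar>z j \<omega>\<bar>)" for j
    by (rule integrable_const_bound[where B = 1]) (use meas bound in auto)
  have int_le: "(LINT \<omega>|P. \<bar>z j \<omega>\<bar>) \<le> 1" for j
    using integral_mono_AE[OF int_z integrable_const bound[of j]] by (simp add: prob_space)
  have int: "integrable P (\<lambda>\<omega>. \<bar>z j \<omega>\<bar> * w j)" for j
    using int_z by simp
  have "AE \<omega> in P. \<forall>j. \<bar>z j \<omega>\<bar> \<le> 1"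
    using bound by (simp add: AE_all_countable)
  then have ae_sum: "AE \<omega> in P. summable (\<lambda>j. \<bar>z j \<omega>\<bar> * w j)"
  proof (rule AE_mp, intro AE_I2 impI)
    fix \<omega> assume "\<forall>j. \<bar>z j \<omega>\<bar> \<le> 1"
    then show "summable (\<lambda>j. \<bar>z j \<omega>\<bar> * w j)"
      by (intro summable_comparison_test'[OF w(2), of 0])
         (use w(1) mult_right_mono[of "\<bar>z _ \<omega>\<bar>" 1 "w _"] in \<open>auto simp: abs_mult\<close>)
  qed
  then have ae: "AE \<omega> in P. summable (\<lambda>j. norm (\<bar>z j \<omega>\<bar> * w j))"
    using w(1) by (simp add: abs_mult)
  have sum_int: "summable (\<lambda>j. LINT \<omega>|P. norm (\<bar>z j \<omega>\<bar> * w j))"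
  proof (rule summable_comparison_test'[OF w(2), of 0])
    fix j
    have "(LINT \<omega>|P. norm (\<bar>z j \<omega>\<bar> * w j)) = (LINT \<omega>|P. \<bar>z j \<omega>\<bar>) * w j"
      using w(1)[of j] by (simp add: abs_mult)
    then show "norm (LINT \<omega>|P. norm (\<bar>z j \<omega>\<bar> * w j)) \<le> w j"
      using mult_right_mono[OF int_le w(1)] w(1)[of j] by (simp add: abs_mult)
  qed
  show "integrable P (\<lambda>\<omega>. \<Sum>j. \<bar>z j \<omega>\<bar> * w j)"
    by (rule integrable_suminf[OF int ae sum_int])
  show "AE \<omega> in P. (\<Sum>j. \<bar>z j \<omega>\<bar> * w j) \<ge> 0"
    using ae_sum by eventually_elim (auto intro!: suminf_nonneg simp: w)
  show "(LINT \<omega>|P. (\<Sum>j. \<bar>z j \<omega>\<bar> * w j)) = (\<Sum>j. (LINT \<omega>|P. \<bar>z j \<omega>\<bar>) * w j)"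
    using integral_suminf[OF int ae sum_int] by simp
qed

text \<open>
  Only the support of the density matters here, so the normalising constant \<open>m\<close> is left arbitrary.
\<close>

lemma uniform_AE_bounded:
  fixes X :: "'w \<Rightarrow> real" and m :: real
  assumes "distributed P lborel X (\<lambda>x. indicator {-1..1} x / m)"
  shows "AE \<omega> in P. \<bar>X \<omega>\<bar> \<le> 1"
proof -
  note [measurable] = distributed_borel_measurable[OF assms]
  have "AE x in distr P lborel X. \<bar>x\<bar> \<le> 1"
    unfolding distributed_distr_eq_density[OF assms]
    by (subst AE_density) (auto simp: indicator_def)
  then show ?thesis
    by (rule AE_distrD[OF distributed_measurable[OF assms]])
qed

lemma le_powr_neg_half_if_square_le:
  fixes x K \<beta> :: real
  assumes "\<beta> > 0" "K \<ge> 0" "x\<^sup>2 * \<beta> \<le> 3 * K\<^sup>2"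
  shows "x \<le> sqrt 3 * K * \<beta> powr (-1/2)"
proof -
  have "x * sqrt \<beta> \<le> sqrt 3 * K"
    by (rule power2_le_imp_le) (use assms in \<open>auto simp: power_mult_distrib\<close>)
  then show ?thesis
    using assms(1) by (simp add: powr_minus powr_half_sqrt field_simps)
qed

theorem mainTheorem7:
  fixes L :: "real^'d"
    and r \<rho> c c\<^sub>\<beta> \<kappa> :: real
    and a :: "real \<Rightarrow> real^'d \<Rightarrow> real"
    and b :: "real \<Rightarrow> real^'d \<Rightarrow> real^'d"
    and P :: "'w measure"
    and \<nu>\<^sub>0 :: "real^'d \<Rightarrow> real"
    and \<psi> :: "nat \<Rightarrow> real^'d \<Rightarrow> real"
    and z :: "nat \<Rightarrow> 'w \<Rightarrow> real"
    and \<nu> :: "'w \<Rightarrow> real^'d \<Rightarrow> real"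
    and Nbar :: nat
  defines "D \<equiv> box 0 L"
  defines "\<mu> \<equiv> lebesgue_on D"
  assumes L_pos: "\<forall>n. L $ n > 0"
    and prob: "prob_space P" and complete: "complete_measure P"
    and r: "r \<ge> real CARD('d)"
    and a: "a \<in> Linf_Lp r D"
    and b: "(\<lambda>(t, x). b t x) \<in> Linf (space_time D)"
    and c: "lower_order_const D c"
    and \<rho>: "0 < \<rho>" "\<rho> < 1"
    and c\<^sub>\<beta>: "c\<^sub>\<beta> > 0" "\<forall>N\<ge>1. beta L \<rho> N \<ge> c\<^sub>\<beta> * (real N)\<^sup>2"
    and \<nu>\<^sub>0: "\<nu>\<^sub>0 \<in> Linf \<mu>" "nu_star \<mu> \<nu>\<^sub>0 > 0"
    and \<psi>: "\<forall>j. \<psi> j \<in> Linf \<mu>"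
    and z_indep: "prob_space.indep_vars P (\<lambda>_. borel) z UNIV"
    and z_unif: "\<forall>j. distributed P lborel (z j) (\<lambda>x. indicator {-1..1} x / measure lborel {-1..1})"
    and \<kappa>: "\<kappa> > 0" "summable (\<lambda>j. Linf_norm \<mu> (\<psi> j))"
      "(\<Sum>j. Linf_norm \<mu> (\<psi> j)) \<le> \<kappa> / (1 + \<kappa>) * nu_star \<mu> \<nu>\<^sub>0"
    and \<nu>: "\<forall>\<omega>\<in>space P. AE x in \<mu>. \<nu> \<omega> x = affine_field \<nu>\<^sub>0 \<psi> z \<omega> x"
    and Nbar: "Nbar \<ge> 1"
      "nu_star \<mu> \<nu>\<^sub>0 - sqrt 3 * c * coeff_norm r D a b * beta L \<rho> Nbar powr (-1/2) > 0"
  shows "measure P {\<omega> \<in> space P.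
             (nu_min \<mu> \<nu>\<^sub>0 \<psi> z \<omega>)\<^sup>2 * beta L \<rho> Nbar \<le> 3 * c\<^sup>2 * (coeff_norm r D a b)\<^sup>2}
           \<le> (LINT \<omega>|P. Gamma_sum \<mu> \<psi> z \<omega>)
               / (nu_star \<mu> \<nu>\<^sub>0 - sqrt 3 * c * coeff_norm r D a b * beta L \<rho> Nbar powr (-1/2))
         \<and> (nu_star \<mu> \<nu>\<^sub>0 - sqrt (3 / c\<^sub>\<beta>) * c * coeff_norm r D a b * inverse (real Nbar) > 0 \<longrightarrow>
             (LINT \<omega>|P. Gamma_sum \<mu> \<psi> z \<omega>)
               / (nu_star \<mu> \<nu>\<^sub>0 - sqrt 3 * c * coeff_norm r D a b * beta L \<rho> Nbar powr (-1/2))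
             \<le> (\<Sum>j. (LINT \<omega>|P. \<bar>z j \<omega>\<bar>) * Linf_norm \<mu> (\<psi> j))
               / (nu_star \<mu> \<nu>\<^sub>0 - sqrt (3 / c\<^sub>\<beta>) * c * coeff_norm r D a b * inverse (real Nbar)))"
proof -
  interpret prob_space P by (rule prob)
  define w where "w j = Linf_norm \<mu> (\<psi> j)" for j
  define K where "K = c * coeff_norm r D a b"
  define \<beta> where "\<beta> = beta L \<rho> Nbar"
  define s where "s = nu_star \<mu> \<nu>\<^sub>0 - sqrt 3 * K * \<beta> powr (-1/2)"
  define \<Gamma> where "\<Gamma> \<omega> = Gamma_sum \<mu> \<psi> z \<omega>" for \<omega>
  have \<Gamma>_eq: "\<Gamma> = (\<lambda>\<omega>. \<Sum>j. \<bar>z j \<omega>\<bar> * w j)"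
    by (simp add: \<Gamma>_def Gamma_sum_def w_def fun_eq_iff)
  have K: "K \<ge> 0"
    using c by (simp add: K_def coeff_norm_def Linf_norm_def lower_order_const_def)
  have \<beta>_ge: "c\<^sub>\<beta> * (real Nbar)\<^sup>2 \<le> \<beta>"
    using c\<^sub>\<beta>(2) Nbar(1) by (simp add: \<beta>_def)
  have N: "real Nbar > 0" using Nbar(1) by simp
  have \<beta>: "\<beta> > 0"
    using \<beta>_ge c\<^sub>\<beta>(1) N by (smt (verit) mult_pos_pos zero_less_power)
  have s: "s > 0"
    using Nbar(2) by (simp add: s_def K_def \<beta>_def mult.assoc)
  have z_meas: "z j \<in> borel_measurable P" for j
    using distributed_measurable[OF z_unif[rule_format]] by simp
  have w: "w j \<ge> 0" "summable w" for j
    using \<kappa>(2) by (simp_all add: w_def[abs_def] Linf_norm_def)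
  note series = weighted_abs_series[where z = z and w = w, OF prob z_meas uniform_AE_bounded[OF z_unif[rule_format]] w,
    folded \<Gamma>_eq]
  have \<Gamma>_nonneg: "AE \<omega> in P. \<Gamma> \<omega> \<ge> 0"
    using series(2) by (simp add: \<Gamma>_eq)
  have [measurable]: "\<Gamma> \<in> borel_measurable P"
    using series(1) by (simp add: \<Gamma>_eq)
  have "measure P {\<omega> \<in> space P. (nu_min \<mu> \<nu>\<^sub>0 \<psi> z \<omega>)\<^sup>2 * \<beta> \<le> 3 * K\<^sup>2}
      \<le> measure P {\<omega> \<in> space P. \<Gamma> \<omega> \<ge> s}"
  proof (rule finite_measure_mono)
    show "{\<omega> \<in> space P. (nu_min \<mu> \<nu>\<^sub>0 \<psi> z \<omega>)\<^sup>2 * \<beta> \<le> 3 * K\<^sup>2} \<subseteq> {\<omega> \<in> space P. \<Gamma> \<omega> \<ge> s}"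
    proof safe
      fix \<omega> assume "(nu_min \<mu> \<nu>\<^sub>0 \<psi> z \<omega>)\<^sup>2 * \<beta> \<le> 3 * K\<^sup>2"
      from le_powr_neg_half_if_square_le[OF \<beta> K this] show "\<Gamma> \<omega> \<ge> s"
        by (simp add: nu_min_def s_def \<Gamma>_def Gamma_sum_def)
    qed
  qed measurable
  also have "\<dots> \<le> (LINT \<omega>|P. \<Gamma> \<omega>) / s"
    using integral_Markov_inequality_measure[OF series(1) sets.top \<Gamma>_nonneg s] by simp
  finally have tail: "measure P {\<omega> \<in> space P. (nu_min \<mu> \<nu>\<^sub>0 \<psi> z \<omega>)\<^sup>2 * \<beta> \<le> 3 * K\<^sup>2}
      \<le> (LINT \<omega>|P. \<Gamma> \<omega>) / s" .
  define s' where "s' = nu_star \<mu> \<nu>\<^sub>0 - sqrt (3 / c\<^sub>\<beta>) * K * inverse (real Nbar)"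
  have "sqrt c\<^sub>\<beta> * real Nbar \<le> sqrt \<beta>"
    using real_sqrt_le_mono[OF \<beta>_ge] N by (simp add: real_sqrt_mult)
  then have "inverse (sqrt \<beta>) \<le> inverse (sqrt c\<^sub>\<beta> * real Nbar)"
    by (rule le_imp_inverse_le) (use c\<^sub>\<beta>(1) N in simp)
  from mult_left_mono[OF this, of "sqrt 3 * K"] have "s' \<le> s"
    using K \<beta> by (simp add: s_def s'_def powr_minus powr_half_sqrt real_sqrt_divide field_simps)
  moreover have "(LINT \<omega>|P. \<Gamma> \<omega>) \<ge> 0"
    using \<Gamma>_nonneg by (rule integral_nonneg_AE)
  ultimately have antimono: "s' > 0 \<longrightarrow> (LINT \<omega>|P. \<Gamma> \<omega>) / s \<le> (LINT \<omega>|P. \<Gamma> \<omega>) / s'"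
    by (auto intro: divide_left_mono)
  have "(LINT \<omega>|P. \<Gamma> \<omega>) = (\<Sum>j. (LINT \<omega>|P. \<bar>z j \<omega>\<bar>) * w j)"
    using series(3) by simp
  with tail antimono show ?thesis
    by (simp add: \<Gamma>_def w_def K_def s_def s'_def \<beta>_def power_mult_distrib mult.assoc)
qed

end
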